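(* Let $Q:C_+\to C_+$ satisfy (A1)–(A4), with associated limit maps $Q_\pm$ and $r^*\in\mathrm{Int}(Y_+)$. Assume that $Q_-$ satisfies (UAA), that $Q_+$ satisfies (UC) with constants $c_-^*,c_+^*$, and that either $Q$ is subhomogeneous on $[0,r^*]_C$ and satisfies (SP), or $Q$ satisfies (ASH-UC-SP) (in which case $c_\pm^*=\lim_{l\to\infty}c_{\pm l}^*$). If $c_-^*>0$ and $\{Q^n[r^*]:n\in\mathbb N\}$ is precompact in $C$, then the following statements are valid. (i) If $c_+^*>0$, then $Q$ has a nontrivial fixed point $W$ in $C_+$ (that is, $W\in C_+\setminus\{0\}$ and $Q[W]=W$) such that $W(\cdot,-\infty)=0$, $W(\cdot,\infty)=r^*$, and $W(\cdot,s)$ is nondecreasing in $s\in\mathbb R$. (ii) If $c_+^*\le0$ and $\{(T_{x_0}\circ Q)^n[r^*]:n\in\mathbb N\}$ is precompact in $C$ for some $x_0\in(-c_+^*,c_-^* )$, then $Q$ has a nontrivial fixed point $W$ in $C_+$ such that $W(\cdot,-\infty)=0$, $W(\cdot,\infty)=r^*$, and $W(\cdot,s)$ is nondecreasing in $s\in\mathbb R$.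
   Context: Spaces. Fix $N\ge1$ and a compact topological space $M$. $X$ is the space of bounded continuous functions $\mathbb R\to\mathbb R^N$ with norm $\|\phi\|_X=\sum_{n\ge1}2^{-n}\sup_{|x|\le n}\|\phi(x)\|_{\mathbb R^N}$. $C=C(M,X)$ with norm $\sup_{\theta\in M}\|\varphi(\theta)\|_X$; elements of $C$ are identified with bounded continuous functions $\varphi(\theta,x)$ from $M\times\mathbb R$ to $\mathbb R^N$. $C_+=\{\varphi\in C:\varphi(\theta,x)\in\mathbb R_+^N\ \forall(\theta,x)\}$. $Y=C(M,\mathbb R^N)$ with sup norm, $Y_+=C(M,\mathbb R^N_+)$, $\mathrm{Int}(Y_+)=\{\beta\in Y:\beta(\theta)\in \mathrm{Int}(\mathbb R^N_+)\ \forall\theta\}$. Vectors of $\mathbb R^N$ and elements of $Y$ are identified with the elements of $C$ that are constant in the remaining variables. Order relations $\le$ and suprema of $\mathbb R^N$-valued quantities are pointwise and componentwise. For $\psi\in C_+$, $C_\psi=[0,\psi]_C=\{\varphi\in C:0\le\varphi\le\psi\}$. $T_y[\varphi](\theta,x)=\varphi(\theta,x-y)$ for $y\in\mathbb R$. $W(\cdot,\pm\infty)=\lim_{s\to\pm\infty}W(\cdot,s)$ in $Y$. Standing assumptions on a map $Q:C_+\to C_+$: (A1) $T_{-y}\circ Q[\varphi]\ge Q\circ T_{-y}[\varphi]$ for all $\varphi\in C_+$, $y\ge0$. (A2) For every vector $r\in\mathrm{Int}(\mathbb R_+^N)$, $Q|_{C_r}:C_r\to C_+$ is continuous, and monotone: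 $Q[\phi]\le Q[\psi]$ whenever $\phi\le\psi$ in $C_r$. By (A1), $T_{-y}\circ Q\circ T_y[\varphi](\theta,x)$ is nondecreasing in $y$; define $Q_\pm:C_+\to L^\infty(M\times\mathbb R,\mathbb R^N)$ by $Q_\pm[\varphi](\theta,x)=\lim_{y\to\pm\infty}T_{-y}\circ Q\circ T_y[\varphi](\theta,x)$. (A3) For all $\varphi\in C_+$, $n\in\mathbb N$: $T_{-y}\circ Q^n\circ T_y[\varphi]\to Q_\pm^n[\varphi]$ in $C$ as $y\to\pm\infty$. (A4) For every vector $r\in\mathrm{Int}(\mathbb R^N_+)$, $Q_\pm|_{C_r}:C_r\to C_+$ is continuous, $Q_+[0]=0$, and $Q_+[r^*]=r^*$ for some $r^*\in\mathrm{Int}(Y_+)$ (fixed). Properties: (SP) There is $N^*>0$ such that $Q^n[\varphi](\theta,x)\in\mathrm{Int}(\mathbb R^N_+)$ for all $n\ge N^*$, $(\theta,x)\in M\times(0,\infty)$, $\varphi\in C_+\setminus\{0\}$. (UC) There are $c_-^*,c_+^*\in\mathbb R$ with $c_+^*+c_-^*>0$ and $\lim_{n\to\infty}\max_{x\in n[-c_-^*+\varepsilon,\,c_+^*-\varepsilon]}\|Q_+^n[\varphi](\cdot,x)-r^*\|_Y=0$ for all $\varepsilon\in(0,\frac{c_+^*+c_-^*}{2})$ and $\varphi\in C_+\setminus\{0\}$. (UAA) $\lim_{n\to\infty}\sup_{(\theta,x)\in M\times\mathbb R}Q_-^n[\varphi](\theta,x)=0$ for all $\varphi\in C_+$. Subhomogeneity: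 $Q$ is subhomogeneous on $[0,r^*]_C$ if $Q[\kappa\phi]\ge\kappa Q[\phi]$ for all $\kappa\in[0,1]$, $\phi\in[0,r^*]_C$. (ASH-UC-SP) There are sequences $\{c_{\pm l}^*\}_{l\ge1}$ in $\mathbb R$, $\{r_l^*\}_{l\ge1}$ in $\mathrm{Int}(Y_+)$ and maps $Q_l:C_+\to C_+$ such that for every $l\geq 1$: (i) $Q_l$ satisfies (A1) and (A2), $Q_l[0]=0$, and $Q\ge Q_l$ on $C_{r^*}$; (ii) $T_{-y}\circ Q_l\circ T_y[\varphi]\to Q_l^+[\varphi]$ in $C$ as $y\to\infty$ for all $\varphi\in C_+$, where $Q_l^+[r_l^*]=r_l^*\le r^*$; (iii) $Q_l$ is subhomogeneous on $[0,r_l^*]_C$; (iv) $Q_l$ satisfies (SP), and $Q_l^+$ satisfies (UC) with $c_{-l}^*,c_{+l}^*,r_l^*$ in place of $c_-^*,c_+^*,r^*$. *)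

theory Defs
  imports "HOL-Analysis.Analysis"
begin

text \<open>The norm of \<open>X\<close>. The series over \<open>n \<ge> 1\<close> is indexed by \<open>Suc n\<close>.\<close>

definition X_norm :: "(real \<Rightarrow> real ^ 'n) \<Rightarrow> real" where
  "X_norm f = (\<Sum>n. (SUP x\<in>{- real (Suc n)..real (Suc n)}. norm (f x)) / 2 ^ Suc n)"

text \<open>The space \<open>C = C(M,X)\<close>, where \<open>M\<close> is the type \<open>'m\<close> (compactness of \<open>M\<close> is a hypothesis of
  the theorem) and \<open>\<real>\<^sup>N\<close> is \<open>real ^ 'n\<close>. Its elements are the bounded continuous functions of
  \<open>(\<theta>, x)\<close>. It is a separate type, because the norm of
  \<open>('m \<times> real) \<Rightarrow>\<^sub>C (real ^ 'n)\<close> is the supremum norm, which gives a finer topology.\<close>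

typedef (overloaded) ('m, 'n) CMX =
  "bcontfun :: ('m::topological_space \<times> real \<Rightarrow> real ^ 'n::finite) set"
  morphisms ev Abs_CMX
  using const_bcontfun by blast

setup_lifting type_definition_CMX

lemma CMX_eqI: "(\<And>p. ev f p = ev g p) \<Longrightarrow> f = g"
  by transfer auto

lemma continuous_on_ev: "continuous_on S (ev f)"
  using ev[of f] by (auto simp: bcontfun_def intro: continuous_on_subset)

lemma bounded_ev: "bounded (range (ev f))"
  using ev[of f] by (auto simp: bcontfun_def)

instantiation CMX :: (topological_space, finite) real_vector
begin

lift_definition uminus_CMX :: "('a, 'b) CMX \<Rightarrow> ('a, 'b) CMX" is "\<lambda>f p. - f p"
  by (rule uminus_cont)

lift_definition plus_CMX :: "('a, 'b) CMX \<Rightarrow> ('a, 'b) CMX \<Rightarrow> ('a, 'b) CMX" is "\<lambda>f g p. f p + g p"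
  by (rule plus_cont)

lift_definition minus_CMX :: "('a, 'b) CMX \<Rightarrow> ('a, 'b) CMX \<Rightarrow> ('a, 'b) CMX" is "\<lambda>f g p. f p - g p"
  by (rule minus_cont)

lift_definition zero_CMX :: "('a, 'b) CMX" is "\<lambda>_. 0"
  by (rule const_bcontfun)

lift_definition scaleR_CMX :: "real \<Rightarrow> ('a, 'b) CMX \<Rightarrow> ('a, 'b) CMX" is "\<lambda>c f p. c *\<^sub>R f p"
  by (rule scaleR_cont)

instance
  by standard
    (auto intro!: CMX_eqI simp: uminus_CMX.rep_eq plus_CMX.rep_eq minus_CMX.rep_eq
      zero_CMX.rep_eq scaleR_CMX.rep_eq algebra_simps)

end

instantiation CMX :: (topological_space, finite) order
begin

lift_definition less_eq_CMX :: "('a, 'b) CMX \<Rightarrow> ('a, 'b) CMX \<Rightarrow> bool" is "\<lambda>f g. \<forall>p. f p \<le> g p" .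

definition less_CMX :: "('a, 'b) CMX \<Rightarrow> ('a, 'b) CMX \<Rightarrow> bool" where
  "less_CMX f g \<longleftrightarrow> f \<le> g \<and> \<not> g \<le> f"

instance
proof
  fix f g h :: "('a, 'b) CMX"
  show "f < g \<longleftrightarrow> f \<le> g \<and> \<not> g \<le> f"
    by (rule less_CMX_def)
  show "f \<le> f"
    by (simp add: less_eq_CMX.rep_eq)
  show "f \<le> h" if "f \<le> g" "g \<le> h"
    using that unfolding less_eq_CMX.rep_eq by (blast intro: order.trans)
  show "f = g" if "f \<le> g" "g \<le> f"
    using that unfolding less_eq_CMX.rep_eq by (blast intro: CMX_eqI antisym)
qed

end

lemma X_norm_aux:
  assumes "\<And>x. norm (f x) \<le> B"
  shows SUP_norm_le: "a \<le> b \<Longrightarrow> (SUP x\<in>{a..b::real}. norm (f x)) \<le> B"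
    and bdd_above_norm: "bdd_above ((\<lambda>x. norm (f x)) ` S)"
    and SUP_norm_nonneg: "a \<le> b \<Longrightarrow> 0 \<le> (SUP x\<in>{a..b::real}. norm (f x))"
proof -
  show bdd: "bdd_above ((\<lambda>x. norm (f x)) ` S)" for S
    using assms by (auto intro!: bdd_aboveI)
  show "a \<le> b \<Longrightarrow> (SUP x\<in>{a..b::real}. norm (f x)) \<le> B"
    using assms by (intro cSUP_least) auto
  assume "a \<le> b"
  then have "norm (f a) \<le> (SUP x\<in>{a..b::real}. norm (f x))"
    by (intro cSUP_upper bdd) auto
  then show "0 \<le> (SUP x\<in>{a..b::real}. norm (f x))"
    by (rule order.trans[OF norm_ge_zero])
qed

lemma sums_geometric_half: "(\<lambda>n. B / 2 ^ Suc n) sums (B::real)"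
  using sums_mult[OF power_half_series, of B] by (simp add: power_divide)

lemma X_norm_summable:
  assumes "\<And>x. norm (f x) \<le> B"
  shows "summable (\<lambda>n. (SUP x\<in>{- real (Suc n)..real (Suc n)}. norm (f x)) / 2 ^ Suc n)"
proof (rule summable_comparison_test')
  show "summable (\<lambda>n. B / 2 ^ Suc n)"
    using sums_geometric_half by (rule sums_summable)
  show "norm ((SUP x\<in>{- real (Suc n)..real (Suc n)}. norm (f x)) / 2 ^ Suc n) \<le> B / 2 ^ Suc n"
    if "n \<ge> 0" for n
    using SUP_norm_le[of f B "- real (Suc n)" "real (Suc n)"] 
      SUP_norm_nonneg[of f B "- real (Suc n)" "real (Suc n)"] assms
    by (simp add: divide_right_mono)
qed

lemma X_norm_le:
  assumes "\<And>x. norm (f x) \<le> B"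
  shows "X_norm f \<le> B"
proof -
  have "X_norm f \<le> (\<Sum>n. B / 2 ^ Suc n)"
    unfolding X_norm_def
    using X_norm_summable[OF assms] sums_summable[OF sums_geometric_half]
    by (intro suminf_le divide_right_mono SUP_norm_le assms) auto
  then show ?thesis
    using sums_unique[OF sums_geometric_half[of B]] by simp
qed

lemma X_norm_ge_point:
  assumes "\<And>x. norm (f x) \<le> B" and "\<bar>x\<bar> \<le> real (Suc n)"
  shows "norm (f x) / 2 ^ Suc n \<le> X_norm f"
proof -
  have "norm (f x) \<le> (SUP x\<in>{- real (Suc n)..real (Suc n)}. norm (f x))"
    using assms(2) by (intro cSUP_upper bdd_above_norm[OF assms(1)]) auto
  then have "norm (f x) / 2 ^ Suc n \<le> (SUP x\<in>{- real (Suc n)..real (Suc n)}. norm (f x)) / 2 ^ Suc n"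
    by (intro divide_right_mono) auto
  also have "\<dots> \<le> X_norm f"
    unfolding X_norm_def
    using sum_le_suminf[OF X_norm_summable[OF assms(1)], of "{n}"]
      SUP_norm_nonneg[OF assms(1)] by (simp del: of_nat_Suc)
  finally show ?thesis .
qed

lemma X_norm_triangle:
  fixes f g :: "real \<Rightarrow> real ^ 'n"
  assumes f: "\<And>x. norm (f x) \<le> A" and g: "\<And>x. norm (g x) \<le> B"
  shows "X_norm (\<lambda>x. f x + g x) \<le> X_norm f + X_norm g"
proof -
  define S where "S h n = (SUP x\<in>{- real (Suc n)..real (Suc n)}. norm (h x))"
    for h :: "real \<Rightarrow> real ^ 'n" and n
  have summ: "summable (\<lambda>n. S h n / 2 ^ Suc n)" if "\<And>x. norm (h x) \<le> K" for h K
    unfolding S_def using that by (rule X_norm_summable)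
  have fg: "norm (f x + g x) \<le> A + B" for x
    by (intro norm_triangle_le add_mono f g)
  have "S (\<lambda>x. f x + g x) n \<le> S f n + S g n" for n
    unfolding S_def
    by (intro cSUP_least norm_triangle_le add_mono cSUP_upper bdd_above_norm[OF f]
        bdd_above_norm[OF g]) auto
  then have "S (\<lambda>x. f x + g x) n / 2 ^ Suc n \<le> S f n / 2 ^ Suc n + S g n / 2 ^ Suc n" for n
    unfolding add_divide_distrib[symmetric] by (intro divide_right_mono) auto
  then have "(\<Sum>n. S (\<lambda>x. f x + g x) n / 2 ^ Suc n) \<le> (\<Sum>n. S f n / 2 ^ Suc n + S g n / 2 ^ Suc n)"
    by (intro suminf_le summable_add summ[OF f] summ[OF g] summ[OF fg])
  also have "\<dots> = (\<Sum>n. S f n / 2 ^ Suc n) + (\<Sum>n. S g n / 2 ^ Suc n)"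
    by (rule suminf_add[OF summ[OF f] summ[OF g], symmetric])
  finally show ?thesis
    unfolding X_norm_def S_def .
qed

lemma X_norm_scaleR_le:
  fixes f :: "real \<Rightarrow> real ^ 'n"
  assumes f: "\<And>x. norm (f x) \<le> B"
  shows "X_norm (\<lambda>x. c *\<^sub>R f x) \<le> \<bar>c\<bar> * X_norm f"
proof -
  define S where "S h n = (SUP x\<in>{- real (Suc n)..real (Suc n)}. norm (h x))"
    for h :: "real \<Rightarrow> real ^ 'n" and n
  have summ: "summable (\<lambda>n. S h n / 2 ^ Suc n)" if "\<And>x. norm (h x) \<le> K" for h K
    unfolding S_def using that by (rule X_norm_summable)
  have cf: "norm (c *\<^sub>R f x) \<le> \<bar>c\<bar> * B" for x
    using f by (simp add: mult_left_mono)
  have "S (\<lambda>x. c *\<^sub>R f x) n \<le> \<bar>c\<bar> * S f n" for n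
    unfolding S_def norm_scaleR
    by (intro cSUP_least mult_left_mono cSUP_upper bdd_above_norm[OF f]) auto
  then have "S (\<lambda>x. c *\<^sub>R f x) n / 2 ^ Suc n \<le> \<bar>c\<bar> * (S f n / 2 ^ Suc n)" for n
    unfolding times_divide_eq_right by (intro divide_right_mono) auto
  then have "(\<Sum>n. S (\<lambda>x. c *\<^sub>R f x) n / 2 ^ Suc n) \<le> (\<Sum>n. \<bar>c\<bar> * (S f n / 2 ^ Suc n))"
    by (intro suminf_le summable_mult summ[OF f] summ[OF cf])
  also have "\<dots> = \<bar>c\<bar> * (\<Sum>n. S f n / 2 ^ Suc n)"
    by (rule suminf_mult[OF summ[OF f]])
  finally show ?thesis
    unfolding X_norm_def S_def .
qed

lemma ev_bound_obtains:
  obtains B where "\<And>p. norm (ev f p) \<le> B"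
  using bounded_ev[of f] by (auto simp: bounded_iff)

instantiation CMX :: (topological_space, finite) real_normed_vector
begin

definition norm_CMX :: "('a, 'b) CMX \<Rightarrow> real" where
  "norm_CMX f = (SUP \<theta>. X_norm (\<lambda>x. ev f (\<theta>, x)))"

definition dist_CMX :: "('a, 'b) CMX \<Rightarrow> ('a, 'b) CMX \<Rightarrow> real" where
  "dist_CMX f g = norm (f - g)"

definition sgn_CMX :: "('a, 'b) CMX \<Rightarrow> ('a, 'b) CMX" where
  "sgn_CMX f = f /\<^sub>R norm f"

definition uniformity_CMX :: "(('a, 'b) CMX \<times> ('a, 'b) CMX) filter" where
  "uniformity_CMX = (INF e\<in>{0<..}. principal {(f, g). dist f g < e})"

definition open_CMX :: "('a, 'b) CMX set \<Rightarrow> bool" where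
  "open_CMX S = (\<forall>f\<in>S. \<forall>\<^sub>F (f', g) in uniformity. f' = f \<longrightarrow> g \<in> S)"

lemma X_norm_le_norm_CMX: "X_norm (\<lambda>x. ev f (\<theta>, x)) \<le> norm f" for f :: "('a, 'b) CMX"
proof -
  obtain B where B: "\<And>p. norm (ev f p) \<le> B"
    using ev_bound_obtains[of f] by blast
  show ?thesis
    unfolding norm_CMX_def by (intro cSUP_upper bdd_aboveI[of _ B]) (auto intro: X_norm_le B)
qed

lemma norm_CMX_scaleR_le: "norm (c *\<^sub>R f) \<le> \<bar>c\<bar> * norm f" for f :: "('a, 'b) CMX"
proof -
  obtain B where B: "\<And>p. norm (ev f p) \<le> B"
    using ev_bound_obtains[of f] by blast
  show ?thesis
    unfolding norm_CMX_def[of "c *\<^sub>R f"] scaleR_CMX.rep_eq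
    by (intro cSUP_least order.trans[OF X_norm_scaleR_le[OF B]] mult_left_mono
        X_norm_le_norm_CMX) auto
qed

instance
proof
  fix c :: real and f g :: "('a, 'b) CMX"
  obtain A where A: "\<And>p. norm (ev f p) \<le> A"
    using ev_bound_obtains[of f] by blast
  obtain B where B: "\<And>p. norm (ev g p) \<le> B"
    using ev_bound_obtains[of g] by blast
  show "norm (f + g) \<le> norm f + norm g"
    unfolding norm_CMX_def[of "f + g"] plus_CMX.rep_eq
    by (intro cSUP_least order.trans[OF X_norm_triangle[OF A B]] add_mono X_norm_le_norm_CMX) auto
  show "norm f = 0 \<longleftrightarrow> f = 0"
  proof
    assume f0: "norm f = 0"
    show "f = 0"
    proof (rule CMX_eqI)
      fix p :: "'a \<times> real"
      obtain \<theta> x where p: "p = (\<theta>, x)"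
        by (cases p)
      obtain n where "\<bar>x\<bar> \<le> real n"
        using real_arch_simple by blast
      then have "norm (ev f (\<theta>, x)) / 2 ^ Suc n \<le> X_norm (\<lambda>x. ev f (\<theta>, x))"
        by (intro X_norm_ge_point[OF A]) auto
      also have "\<dots> \<le> 0"
        using X_norm_le_norm_CMX[of f \<theta>] f0 by simp
      finally have "norm (ev f (\<theta>, x)) \<le> 0 * 2 ^ Suc n"
        by (subst (asm) pos_divide_le_eq) auto
      then show "ev f p = ev 0 p"
        unfolding p zero_CMX.rep_eq by simp
    qed
  qed (simp add: norm_CMX_def zero_CMX.rep_eq X_norm_def)
  show "norm (c *\<^sub>R f) = \<bar>c\<bar> * norm f"
  proof (cases "c = 0")
    case True
    then show ?thesis
      by (simp add: norm_CMX_def zero_CMX.rep_eq X_norm_def)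
  next
    case False
    have "norm f = norm (inverse c *\<^sub>R c *\<^sub>R f)"
      using False by simp
    also have "\<dots> \<le> \<bar>inverse c\<bar> * norm (c *\<^sub>R f)"
      by (rule norm_CMX_scaleR_le)
    finally have "\<bar>c\<bar> * norm f \<le> norm (c *\<^sub>R f)"
      using False by (simp add: field_simps)
    then show ?thesis
      using norm_CMX_scaleR_le[of c f] by simp
  qed
qed (auto simp: dist_CMX_def sgn_CMX_def uniformity_CMX_def open_CMX_def)

end

definition C_plus :: "('m::topological_space, 'n::finite) CMX set" where
  "C_plus = {\<phi>. 0 \<le> \<phi>}"

definition Int_R_plus :: "(real ^ 'n::finite) set" where
  "Int_R_plus = interior {v. 0 \<le> v}"

text \<open>As \<open>M\<close> is compact, \<open>Y = C(M,\<real>\<^sup>N)\<close> with the supremum norm is \<open>'m \<Rightarrow>\<^sub>C (real ^ 'n)\<close>.\<close>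

definition Int_Y_plus :: "('m::topological_space \<Rightarrow>\<^sub>C (real ^ 'n::finite)) set" where
  "Int_Y_plus = {\<beta>. \<forall>\<theta>. apply_bcontfun \<beta> \<theta> \<in> Int_R_plus}"

text \<open>The identifications of elements of \<open>Y\<close> and of vectors with elements of \<open>C\<close>.\<close>

lift_definition of_Y :: "('m::topological_space \<Rightarrow>\<^sub>C (real ^ 'n::finite)) \<Rightarrow> ('m, 'n) CMX"
  is "\<lambda>\<beta> (\<theta>, x). apply_bcontfun \<beta> \<theta>"
proof -
  fix \<beta> :: "'m \<Rightarrow>\<^sub>C (real ^ 'n)"
  have "continuous_on UNIV (\<lambda>p :: 'm \<times> real. apply_bcontfun \<beta> (fst p))"
    by (rule continuous_on_compose2[OF continuous_on_apply_bcontfun[of UNIV]])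
      (auto intro: continuous_intros)
  moreover have "bounded (range (\<lambda>p :: 'm \<times> real. apply_bcontfun \<beta> (fst p)))"
    by (rule bounded_subset[OF bounded_apply_bcontfun[of \<beta>]]) auto
  ultimately show "(\<lambda>(\<theta>, x). apply_bcontfun \<beta> \<theta>) \<in> (bcontfun :: ('m \<times> real \<Rightarrow> _) set)"
    by (simp add: bcontfun_def case_prod_unfold)
qed

definition of_vec :: "real ^ 'n::finite \<Rightarrow> ('m::topological_space, 'n) CMX" where
  "of_vec r = of_Y (const_bcontfun r)"

definition slice :: "('m::topological_space, 'n::finite) CMX \<Rightarrow> real \<Rightarrow> ('m \<Rightarrow>\<^sub>C (real ^ 'n))" where
  "slice \<phi> x = Bcontfun (\<lambda>\<theta>. ev \<phi> (\<theta>, x))"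

lemma apply_slice [simp]: "apply_bcontfun (slice \<phi> x) \<theta> = ev \<phi> (\<theta>, x)"
proof -
  have "continuous_on UNIV (\<lambda>\<theta>. ev \<phi> (\<theta>, x))"
    by (rule continuous_on_compose2[OF continuous_on_ev[of UNIV]]) (auto intro!: continuous_intros)
  moreover have "bounded (range (\<lambda>\<theta>. ev \<phi> (\<theta>, x)))"
    by (rule bounded_subset[OF bounded_ev[of \<phi>]]) auto
  ultimately have "(\<lambda>\<theta>. ev \<phi> (\<theta>, x)) \<in> bcontfun"
    by (simp add: bcontfun_def)
  then show ?thesis
    by (simp add: slice_def Bcontfun_inverse)
qed

lift_definition T :: "real \<Rightarrow> ('m::topological_space, 'n::finite) CMX \<Rightarrow> ('m, 'n) CMX"
  is "\<lambda>y \<phi> (\<theta>, x). \<phi> (\<theta>, x - y)"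
proof -
  fix \<phi> :: "'m \<times> real \<Rightarrow> real ^ 'n" and y
  assume \<phi>: "\<phi> \<in> bcontfun"
  have "continuous_on UNIV (\<lambda>p. \<phi> (fst p, snd p - y))"
    by (rule continuous_on_compose2[of UNIV \<phi>]) (use \<phi> in \<open>auto simp: bcontfun_def intro!: continuous_intros\<close>)
  moreover have "bounded (range (\<lambda>p. \<phi> (fst p, snd p - y)))"
    by (rule bounded_subset[of "range \<phi>"]) (use \<phi> in \<open>auto simp: bcontfun_def\<close>)
  ultimately show "(\<lambda>(\<theta>, x). \<phi> (\<theta>, x - y)) \<in> bcontfun"
    by (simp add: bcontfun_def case_prod_unfold)
qed

type_synonym ('m, 'n) CMX_map = "('m, 'n) CMX \<Rightarrow> ('m, 'n) CMX"

definition A1 :: "('m::topological_space, 'n::finite) CMX_map \<Rightarrow> bool" where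
  "A1 Q \<longleftrightarrow> (\<forall>\<phi>\<in>C_plus. \<forall>y\<ge>0. Q (T (- y) \<phi>) \<le> T (- y) (Q \<phi>))"

definition A2 :: "('m::topological_space, 'n::finite) CMX_map \<Rightarrow> bool" where
  "A2 Q \<longleftrightarrow> (\<forall>r\<in>Int_R_plus.
     continuous_on {0..of_vec r} Q \<and>
     (\<forall>\<phi>\<in>{0..of_vec r}. \<forall>\<psi>\<in>{0..of_vec r}. \<phi> \<le> \<psi> \<longrightarrow> Q \<phi> \<le> Q \<psi>))"

text \<open>The limit maps are taken pointwise in \<open>(\<theta>, x)\<close>. The pointwise limit need not be a
  continuous function, in which case \<^const>\<open>Abs_CMX\<close> returns an unspecified element of \<open>C\<close>; but
  convergence in \<open>C\<close> to \<open>Q_plus Q \<phi>\<close> or \<open>Q_minus Q \<phi>\<close>, as (A3) demands, implies pointwise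
  convergence, so that then this element is the pointwise limit.\<close>

definition Q_plus :: "('m::topological_space, 'n::finite) CMX_map \<Rightarrow> ('m, 'n) CMX_map" where
  "Q_plus Q \<phi> = Abs_CMX (\<lambda>p. Lim at_top (\<lambda>y. ev (T (- y) (Q (T y \<phi>))) p))"

definition Q_minus :: "('m::topological_space, 'n::finite) CMX_map \<Rightarrow> ('m, 'n) CMX_map" where
  "Q_minus Q \<phi> = Abs_CMX (\<lambda>p. Lim at_bot (\<lambda>y. ev (T (- y) (Q (T y \<phi>))) p))"

definition A3 :: "('m::topological_space, 'n::finite) CMX_map \<Rightarrow> bool" where
  "A3 Q \<longleftrightarrow> (\<forall>\<phi>\<in>C_plus. \<forall>n.
     ((\<lambda>y. T (- y) ((Q ^^ n) (T y \<phi>))) \<longlongrightarrow> (Q_plus Q ^^ n) \<phi>) at_top \<and>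
     ((\<lambda>y. T (- y) ((Q ^^ n) (T y \<phi>))) \<longlongrightarrow> (Q_minus Q ^^ n) \<phi>) at_bot)"

definition A4 :: "('m::topological_space, 'n::finite) CMX_map \<Rightarrow> ('m \<Rightarrow>\<^sub>C (real ^ 'n)) \<Rightarrow> bool" where
  "A4 Q rs \<longleftrightarrow> (\<forall>r\<in>Int_R_plus.
     Q_plus Q ` {0..of_vec r} \<subseteq> C_plus \<and> continuous_on {0..of_vec r} (Q_plus Q) \<and>
     Q_minus Q ` {0..of_vec r} \<subseteq> C_plus \<and> continuous_on {0..of_vec r} (Q_minus Q)) \<and>
     Q_plus Q 0 = 0 \<and> rs \<in> Int_Y_plus \<and> Q_plus Q (of_Y rs) = of_Y rs"

definition SP :: "('m::topological_space, 'n::finite) CMX_map \<Rightarrow> bool" where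
  "SP Q \<longleftrightarrow> (\<exists>Ns::nat. Ns > 0 \<and>
     (\<forall>n\<ge>Ns. \<forall>\<theta>. \<forall>x>0. \<forall>\<phi>\<in>C_plus - {0}. ev ((Q ^^ n) \<phi>) (\<theta>, x) \<in> Int_R_plus))"

definition UC :: "('m::topological_space, 'n::finite) CMX_map \<Rightarrow> real \<Rightarrow> real \<Rightarrow>
    ('m \<Rightarrow>\<^sub>C (real ^ 'n)) \<Rightarrow> bool" where
  "UC P cm cp rs \<longleftrightarrow> cp + cm > 0 \<and>
     (\<forall>\<epsilon>\<in>{0<..<(cp + cm) / 2}. \<forall>\<phi>\<in>C_plus - {0}.
       (\<lambda>n. SUP x\<in>(*) (real n) ` {- cm + \<epsilon>..cp - \<epsilon>}. norm (slice ((P ^^ n) \<phi>) x - rs)) \<longlonglongrightarrow> 0)"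

text \<open>The supremum in \<open>real ^ 'n\<close> is componentwise.\<close>

definition UAA :: "('m::topological_space, 'n::finite) CMX_map \<Rightarrow> bool" where
  "UAA P \<longleftrightarrow> (\<forall>\<phi>\<in>C_plus. (\<lambda>n. SUP p. ev ((P ^^ n) \<phi>) p) \<longlonglongrightarrow> 0)"

definition subhomogeneous ::
  "('m::topological_space, 'n::finite) CMX_map \<Rightarrow> ('m \<Rightarrow>\<^sub>C (real ^ 'n)) \<Rightarrow> bool" where
  "subhomogeneous Q rs \<longleftrightarrow>
     (\<forall>\<kappa>\<in>{0..1}. \<forall>\<phi>\<in>{0..of_Y rs}. \<kappa> *\<^sub>R Q \<phi> \<le> Q (\<kappa> *\<^sub>R \<phi>))"

definition ASH_UC_SP :: "('m::topological_space, 'n::finite) CMX_map \<Rightarrow> ('m \<Rightarrow>\<^sub>C (real ^ 'n)) \<Rightarrow>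
    (nat \<Rightarrow> real) \<Rightarrow> (nat \<Rightarrow> real) \<Rightarrow> bool" where
  "ASH_UC_SP Q rs cml cpl \<longleftrightarrow> (\<exists>rl Ql. \<forall>l\<ge>1.
     rl l \<in> Int_Y_plus \<and> Ql l \<in> C_plus \<rightarrow> C_plus \<and>
     A1 (Ql l) \<and> A2 (Ql l) \<and> Ql l 0 = 0 \<and> (\<forall>\<phi>\<in>{0..of_Y rs}. Ql l \<phi> \<le> Q \<phi>) \<and>
     (\<forall>\<phi>\<in>C_plus. ((\<lambda>y. T (- y) (Ql l (T y \<phi>))) \<longlongrightarrow> Q_plus (Ql l) \<phi>) at_top) \<and>
     Q_plus (Ql l) (of_Y (rl l)) = of_Y (rl l) \<and> of_Y (rl l) \<le> of_Y rs \<and>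
     subhomogeneous (Ql l) (rl l) \<and>
     SP (Ql l) \<and> UC (Q_plus (Ql l)) (cml l) (cpl l) (rl l))"

text \<open>Precompact means relatively compact.\<close>

definition precompact :: "'a::topological_space set \<Rightarrow> bool" where
  "precompact S \<longleftrightarrow> compact (closure S)"

definition connecting_fixed_point ::
  "('m::topological_space, 'n::finite) CMX_map \<Rightarrow> ('m \<Rightarrow>\<^sub>C (real ^ 'n)) \<Rightarrow> ('m, 'n) CMX \<Rightarrow> bool" where
  "connecting_fixed_point Q rs W \<longleftrightarrow>
     W \<in> C_plus - {0} \<and> Q W = W \<and>
     (slice W \<longlongrightarrow> 0) at_bot \<and> (slice W \<longlongrightarrow> rs) at_top \<and>
     (\<forall>\<theta>. mono (\<lambda>s. ev W (\<theta>, s)))"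

end

theory Submission
  imports Defs
begin

text \<open>
  Write \<open>r\<close> for \<open>rs\<close> and \<open>[0, r]\<close> for the order interval in \<open>C\<close>. As \<open>Q \<le> Q\<^sub>+\<close> and \<open>Q\<^sub>+\<close> fixes \<open>r\<close>,
  the iterates \<open>Q\<^sup>n[r]\<close> decrease in \<open>n\<close>, and by (A1) they increase in the space variable. Precompactness
  gives a cluster point \<open>W\<close>, which by monotonicity is the pointwise limit, is a fixed point, and lies
  above every \<open>\<psi> \<in> [0, r]\<close> with \<open>\<psi> \<le> Q\<^sup>k[\<psi>]\<close> for some \<open>k \<ge> 1\<close> (\<open>greatest_fixed_point\<close>). That
  \<open>W(\<cdot>, -\<infinity>) = 0\<close> follows from \<open>W \<le> Q\<^sup>n[r]\<close>: the left limits of \<open>Q\<^sup>n[r]\<close> are given by \<open>Q\<^sub>-\<^sup>n[r]\<close>,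
  which tends to zero (\<open>slice_tendsto_0\<close>).

  What remains is a bound from below. Choose \<open>x\<^sub>0 \<ge> 0\<close> strictly between \<open>- c\<^sub>+\<close> and \<open>c\<^sub>-\<close>, where
  \<open>x\<^sub>0 = 0\<close> is possible when \<open>c\<^sub>+ > 0\<close>, and put \<open>R = T\<^bsub>x\<^sub>0\<^esub> \<circ> Q\<close>. In the frame that moves along with
  \<open>R\<close> both spreading speeds \<open>c\<^sub>- - x\<^sub>0\<close> and \<open>c\<^sub>+ + x\<^sub>0\<close> are positive. Since (A1) gives
  \<open>T\<^bsub>x\<^sub>0\<^esub> Q \<le> Q T\<^bsub>x\<^sub>0\<^esub>\<close>, the iterates of \<open>R\<close> dominate \<open>T\<^bsub>n x\<^sub>0\<^esub> Q\<^sup>n\<close>, and (A3) together with (UC) shows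
  that \<open>R\<^sup>n\<close>, started from any nonzero profile placed sufficiently far to the right, comes close to \<open>r\<close>
  on a prescribed bounded window around that place (\<open>spreading_lower_bound\<close>). This is used twice. A small
  bump placed far to the right satisfies \<open>\<psi> \<le> R\<^sup>n[\<psi>]\<close> for some \<open>n\<close>, so the limit \<open>V\<close> of \<open>R\<^sup>n[r]\<close> is
  not zero (\<open>bump_below_iterate\<close>); and comparing \<open>V\<close> with its own translates yields \<open>V(\<cdot>, \<infinity>) = r\<close>
  (\<open>fixed_point_tendsto_at_top\<close>). Finally \<open>Q[V]\<close> is the translate of \<open>V\<close> to the left by \<open>x\<^sub>0\<close>, so that
  \<open>V \<le> Q[V]\<close> because \<open>V\<close> is nondecreasing in space. Hence \<open>V \<le> W \<le> r\<close>, and \<open>W\<close> inherits from \<open>V\<close>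
  that it is nonzero and tends to \<open>r\<close>.
\<close>

section \<open>Positive vectors, evaluation and translation\<close>

lemma Int_R_plus_iff: "v \<in> Int_R_plus \<longleftrightarrow> (\<forall>i. 0 < v $ i)" for v :: "real ^ 'n::finite"
proof
  assume "v \<in> Int_R_plus"
  moreover have "Int_R_plus \<subseteq> interior {v :: real ^ 'n. v $ i \<ge> 0}" for i
    unfolding Int_R_plus_def by (intro interior_mono) (auto simp: less_eq_vec_def)
  ultimately show "\<forall>i. 0 < v $ i"
    using interior_halfspace_component_ge by blast
next
  assume "\<forall>i. 0 < v $ i"
  moreover have "open {v :: real ^ 'n. \<forall>i. 0 < v $ i}"
    unfolding Collect_all_eq by (intro open_INT ballI open_Collect_less continuous_intros) simp
  ultimately show "v \<in> Int_R_plus"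
    unfolding Int_R_plus_def
    by (intro interiorI[of "{v. \<forall>i. 0 < v $ i}"]) (auto simp: less_eq_vec_def less_imp_le)
qed

lemma ev_mono: "\<phi> \<le> \<psi> \<Longrightarrow> ev \<phi> p \<le> ev \<psi> p"
  unfolding less_eq_CMX.rep_eq by blast

lemma ev_T [simp]: "ev (T y \<phi>) (\<theta>, x) = ev \<phi> (\<theta>, x - y)"
  by (simp add: T.rep_eq)

lemma ev_of_Y [simp]: "ev (of_Y \<beta>) (\<theta>, x) = apply_bcontfun \<beta> \<theta>"
  by (simp add: of_Y.rep_eq)

lemma ev_of_vec [simp]: "ev (of_vec r) (\<theta>, x) = r"
  by (simp add: of_vec_def const_bcontfun.rep_eq)

lemma CMX_leI: "(\<And>\<theta> x. ev \<phi> (\<theta>, x) \<le> ev \<psi> (\<theta>, x)) \<Longrightarrow> \<phi> \<le> \<psi>"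
  by (auto simp: less_eq_CMX.rep_eq)

lemma ev_0 [simp]: "ev 0 p = 0"
  by (simp add: zero_CMX.rep_eq)

lemma T_T [simp]: "T a (T b \<phi>) = T (a + b) \<phi>"
  by (rule CMX_eqI) (auto simp: algebra_simps)

lemma T_0 [simp]: "T 0 \<phi> = \<phi>"
  by (rule CMX_eqI) auto

lemma T_of_Y [simp]: "T a (of_Y \<beta>) = of_Y \<beta>"
  by (rule CMX_eqI) auto

lemma T_zero [simp]: "T a 0 = 0"
  by (rule CMX_eqI) auto

lemma T_mono: "\<phi> \<le> \<psi> \<Longrightarrow> T a \<phi> \<le> T a \<psi>"
  by (rule CMX_leI) (auto intro: ev_mono)

lemma T_interval:
  assumes "\<phi> \<in> {0..of_Y \<beta>}"
  shows "T a \<phi> \<in> {0..of_Y \<beta>}"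
  using T_mono[of 0 \<phi> a] T_mono[of \<phi> "of_Y \<beta>" a] assms by simp

lemma norm_ev_le:
  fixes f :: "('m::topological_space, 'n::finite) CMX"
  assumes "\<bar>x\<bar> \<le> real (Suc n)"
  shows "norm (ev f (\<theta>, x)) \<le> 2 ^ Suc n * norm f"
proof -
  obtain B where B: "\<And>p. norm (ev f p) \<le> B"
    using ev_bound_obtains[of f] by blast
  have "norm (ev f (\<theta>, x)) / 2 ^ Suc n \<le> norm f"
    using X_norm_ge_point[OF B assms] X_norm_le_norm_CMX[of f \<theta>] by (rule order.trans)
  then show ?thesis
    by (simp add: field_simps)
qed

text \<open>The weights in the norm of \<open>X\<close> are bounded below on bounded sets of \<open>x\<close>, so that
  convergence in \<open>C\<close> is locally uniform in \<open>x\<close> and uniform in \<open>\<theta>\<close>.\<close>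

lemma CMX_tendsto_locally_uniform:
  fixes f :: "'a \<Rightarrow> ('m::topological_space, 'n::finite) CMX"
  assumes "(f \<longlongrightarrow> g) F" and "0 < e"
  shows "\<forall>\<^sub>F y in F. \<forall>\<theta> x. \<bar>x\<bar> \<le> L \<longrightarrow> norm (ev (f y) (\<theta>, x) - ev g (\<theta>, x)) < e"
proof -
  obtain n where n: "L \<le> real n"
    using real_arch_simple by blast
  have "\<forall>\<^sub>F y in F. dist (f y) g < e / 2 ^ Suc n"
    using assms by (intro tendstoD) auto
  then show ?thesis
  proof (rule eventually_mono, intro allI impI)
    fix y \<theta> and x :: real
    assume "dist (f y) g < e / 2 ^ Suc n" and x: "\<bar>x\<bar> \<le> L"
    then have "2 ^ Suc n * norm (f y - g) < e"
      by (simp add: dist_norm field_simps)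
    moreover have "norm (ev (f y - g) (\<theta>, x)) \<le> 2 ^ Suc n * norm (f y - g)"
      using x n by (intro norm_ev_le) auto
    ultimately show "norm (ev (f y) (\<theta>, x) - ev g (\<theta>, x)) < e"
      by (simp add: minus_CMX.rep_eq)
  qed
qed

lemma tendsto_ev:
  fixes f :: "'a \<Rightarrow> ('m::topological_space, 'n::finite) CMX"
  assumes "(f \<longlongrightarrow> g) F"
  shows "((\<lambda>y. ev (f y) p) \<longlongrightarrow> ev g p) F"
proof (rule tendstoI)
  fix e :: real
  assume "0 < e"
  obtain \<theta> x where "p = (\<theta>, x)"
    by (cases p)
  then show "\<forall>\<^sub>F y in F. dist (ev (f y) p) (ev g p) < e"
    using CMX_tendsto_locally_uniform[OF assms \<open>0 < e\<close>, of "\<bar>x\<bar>"]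
    by (auto elim!: eventually_mono simp: dist_norm)
qed

lemma slice_tendstoI:
  assumes "\<And>e. 0 < e \<Longrightarrow> \<forall>\<^sub>F s in F. \<forall>\<theta>. norm (ev \<phi> (\<theta>, s) - apply_bcontfun \<beta> \<theta>) \<le> e"
  shows "(slice \<phi> \<longlongrightarrow> \<beta>) F"
proof (rule tendstoI)
  fix e :: real
  assume "0 < e"
  then have "\<forall>\<^sub>F s in F. \<forall>\<theta>. norm (ev \<phi> (\<theta>, s) - apply_bcontfun \<beta> \<theta>) \<le> e / 2"
    by (intro assms) auto
  then show "\<forall>\<^sub>F s in F. dist (slice \<phi> s) \<beta> < e"
  proof (rule eventually_mono)
    fix s
    assume "\<forall>\<theta>. norm (ev \<phi> (\<theta>, s) - apply_bcontfun \<beta> \<theta>) \<le> e / 2"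
    then have "dist (slice \<phi> s) \<beta> \<le> e / 2"
      by (intro dist_bound) (simp add: dist_norm)
    then show "dist (slice \<phi> s) \<beta> < e"
      using \<open>0 < e\<close> by simp
  qed
qed

section \<open>Iterates that start from a constant supersolution\<close>

locale monotone_system =
  fixes Q :: "('m::topological_space, 'n::finite) CMX_map"
    and rs :: "'m \<Rightarrow>\<^sub>C (real ^ 'n)"
  assumes Q_C_plus: "Q \<in> C_plus \<rightarrow> C_plus"
    and A1: "A1 Q"
    and A2: "A2 Q"
    and rs_nonneg: "0 \<le> of_Y rs"
    and Q_rs_le: "Q (of_Y rs) \<le> of_Y rs"
begin

abbreviation K :: "('m, 'n) CMX set" where
  "K \<equiv> {0..of_Y rs}"

abbreviation R :: "real \<Rightarrow> ('m, 'n) CMX_map" where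
  "R x0 \<equiv> T x0 \<circ> Q"

text \<open>(A2) only speaks of intervals below constant vectors; one of them contains \<open>K\<close>.\<close>

lemma K_subset_vec_interval:
  obtains r where "r \<in> Int_R_plus" "K \<subseteq> {0..of_vec r}"
proof
  let ?r = "\<chi> i. norm rs + 1"
  show "?r \<in> Int_R_plus"
    by (auto simp: Int_R_plus_iff intro: add_nonneg_pos)
  have "of_Y rs \<le> of_vec ?r"
  proof (rule CMX_leI)
    fix \<theta> and x :: real
    have "apply_bcontfun rs \<theta> $ i \<le> norm rs + 1" for i
      using component_le_norm_cart[of "apply_bcontfun rs \<theta>" i] norm_bounded[of rs \<theta>] by linarith
    then show "ev (of_Y rs) (\<theta>, x) \<le> ev (of_vec ?r) (\<theta>, x)"
      by (simp add: less_eq_vec_def)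
  qed
  then show "K \<subseteq> {0..of_vec ?r}"
    by auto
qed

lemma Q_continuous: "continuous_on K Q"
proof -
  obtain r where r: "r \<in> Int_R_plus" "K \<subseteq> {0..of_vec r}"
    by (rule K_subset_vec_interval)
  then have "continuous_on {0..of_vec r} Q"
    using A2 unfolding A2_def by blast
  then show ?thesis
    using r(2) by (rule continuous_on_subset)
qed

lemma Q_mono:
  assumes "\<phi> \<in> K" "\<psi> \<in> K" "\<phi> \<le> \<psi>"
  shows "Q \<phi> \<le> Q \<psi>"
proof -
  obtain r where r: "r \<in> Int_R_plus" "K \<subseteq> {0..of_vec r}"
    by (rule K_subset_vec_interval)
  then have "\<phi> \<in> {0..of_vec r}" "\<psi> \<in> {0..of_vec r}"
    using assms by blast+
  then show ?thesis
    using A2 r(1) assms(3) unfolding A2_def by blast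
qed

lemma Q_in_K: "\<phi> \<in> K \<Longrightarrow> Q \<phi> \<in> K"
  using Q_mono[of \<phi> "of_Y rs"] Q_rs_le Q_C_plus rs_nonneg by (auto simp: C_plus_def)

lemma R_mono: "\<lbrakk>\<phi> \<in> K; \<psi> \<in> K; \<phi> \<le> \<psi>\<rbrakk> \<Longrightarrow> R x0 \<phi> \<le> R x0 \<psi>"
  by (simp add: T_mono Q_mono)

lemma R_in_K: "\<phi> \<in> K \<Longrightarrow> R x0 \<phi> \<in> K"
  unfolding comp_apply by (intro T_interval Q_in_K)

lemma R_pow_in_K: "\<phi> \<in> K \<Longrightarrow> (R x0 ^^ n) \<phi> \<in> K"
proof (induction n)
  case (Suc n)
  then show ?case
    unfolding funpow.simps comp_apply[of "R x0"] by (intro R_in_K)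
qed simp

lemma R_pow_mono: "\<lbrakk>\<phi> \<in> K; \<psi> \<in> K; \<phi> \<le> \<psi>\<rbrakk> \<Longrightarrow> (R x0 ^^ n) \<phi> \<le> (R x0 ^^ n) \<psi>"
proof (induction n)
  case (Suc n)
  then show ?case
    unfolding funpow.simps comp_apply[of "R x0"] by (intro R_mono R_pow_in_K)
qed simp

lemma Q_pow_in_K: "\<phi> \<in> K \<Longrightarrow> (Q ^^ n) \<phi> \<in> K"
  by (induction n) (auto simp del: atLeastAtMost_iff intro: Q_in_K)

lemma rs_in_K: "of_Y rs \<in> K"
  using rs_nonneg by simp

lemma R_pow_rs_decseq: "decseq (\<lambda>n. (R x0 ^^ n) (of_Y rs))"
proof (rule decseq_SucI)
  fix n
  have "(R x0 ^^ n) (R x0 (of_Y rs)) \<le> (R x0 ^^ n) (of_Y rs)"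
    using R_in_K[OF rs_in_K, of x0] by (intro R_pow_mono rs_in_K) auto
  then show "(R x0 ^^ Suc n) (of_Y rs) \<le> (R x0 ^^ n) (of_Y rs)"
    by (simp add: funpow_swap1)
qed

text \<open>This is (A1) for \<open>y = x0\<close>, applied to \<open>T x0 \<phi>\<close>.\<close>

lemma T_Q_le_Q_T:
  assumes "\<phi> \<in> K" and "0 \<le> x0"
  shows "T x0 (Q \<phi>) \<le> Q (T x0 \<phi>)"
proof -
  have "T x0 \<phi> \<in> C_plus"
    using T_interval[OF assms(1), of x0] by (simp add: C_plus_def)
  then have "Q (T (- x0) (T x0 \<phi>)) \<le> T (- x0) (Q (T x0 \<phi>))"
    using A1 assms(2) unfolding A1_def by blast
  then show ?thesis
    using T_mono[of "Q \<phi>" "T (- x0) (Q (T x0 \<phi>))" x0] by simp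
qed

text \<open>\<open>R\<close> and \<open>Q\<close> need not commute with translations, but all the translations in \<open>R\<^sup>n\<close> can be moved
  to the left at the price of an inequality. This compares \<open>R\<^sup>n\<close> with \<open>Q\<^sup>n\<close>, about which (A3)
  speaks.\<close>

lemma T_Q_pow_le_R_pow:
  assumes "\<phi> \<in> K" and "0 \<le> x0"
  shows "T (real n * x0) ((Q ^^ n) \<phi>) \<le> (R x0 ^^ n) \<phi>"
proof (induction n)
  case (Suc n)
  have K: "(Q ^^ n) \<phi> \<in> K"
    using assms(1) by (rule Q_pow_in_K)
  have "T (real n * x0) (Q ((Q ^^ n) \<phi>)) \<le> Q (T (real n * x0) ((Q ^^ n) \<phi>))"
    using K assms(2) by (intro T_Q_le_Q_T) auto
  also have "\<dots> \<le> Q ((R x0 ^^ n) \<phi>)"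
    by (intro Q_mono T_interval R_pow_in_K Suc.IH K assms(1))
  finally have "T x0 (T (real n * x0) (Q ((Q ^^ n) \<phi>))) \<le> T x0 (Q ((R x0 ^^ n) \<phi>))"
    by (rule T_mono)
  moreover have "T (real (Suc n) * x0) ((Q ^^ Suc n) \<phi>) = T x0 (T (real n * x0) (Q ((Q ^^ n) \<phi>)))"
    by (simp add: algebra_simps)
  moreover have "(R x0 ^^ Suc n) \<phi> = T x0 (Q ((R x0 ^^ n) \<phi>))"
    by (simp only: funpow.simps comp_apply)
  ultimately show ?case
    by metis
qed simp

lemma R_preserves_nondecreasing:
  assumes "\<phi> \<in> K" and "\<And>y. 0 \<le> y \<Longrightarrow> \<phi> \<le> T (- y) \<phi>" and "0 \<le> y"
  shows "R x0 \<phi> \<le> T (- y) (R x0 \<phi>)"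
proof -
  have "Q \<phi> \<le> Q (T (- y) \<phi>)"
    using assms by (intro Q_mono T_interval) auto
  also have "\<dots> \<le> T (- y) (Q \<phi>)"
    using A1 assms(1,3) unfolding A1_def by (auto simp: C_plus_def)
  finally show ?thesis
    using T_mono[of "Q \<phi>" "T (- y) (Q \<phi>)" x0] by (simp add: add.commute)
qed

lemma R_pow_rs_nondecreasing:
  "0 \<le> y \<Longrightarrow> (R x0 ^^ n) (of_Y rs) \<le> T (- y) ((R x0 ^^ n) (of_Y rs))"
proof (induction n arbitrary: y)
  case (Suc n)
  then show ?case
    unfolding funpow.simps comp_apply[of "R x0"]
    by (intro R_preserves_nondecreasing R_pow_in_K rs_in_K)
qed simp

text \<open>A decreasing precompact sequence in \<open>C\<close> converges pointwise to any of its cluster points \<open>W\<close>, and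
  continuity of \<open>Q\<close> along a subsequence that converges to \<open>W\<close> in \<open>C\<close> makes \<open>W\<close> a fixed point.
  Iterating \<open>\<psi> \<le> R\<^sup>k[\<psi>]\<close> keeps \<open>\<psi>\<close> below a subsequence of the iterates, hence below \<open>W\<close>; the case
  of general \<open>k \<ge> 1\<close> is used for \<open>\<psi>\<close> a bump and \<open>k = 1\<close> for \<open>\<psi>\<close> a fixed point of a translate of \<open>Q\<close>.\<close>

lemma greatest_fixed_point:
  assumes "precompact (range (\<lambda>n. (R x0 ^^ n) (of_Y rs)))"
  obtains W where "W \<in> K" "R x0 W = W" "\<And>n. W \<le> (R x0 ^^ n) (of_Y rs)"
    "\<And>\<theta>. mono (\<lambda>s. ev W (\<theta>, s))"
    "\<And>\<psi> k. \<lbrakk>\<psi> \<in> K; 1 \<le> k; \<psi> \<le> (R x0 ^^ k) \<psi>\<rbrakk> \<Longrightarrow> \<psi> \<le> W"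
proof -
  define X where "X n = (R x0 ^^ n) (of_Y rs)" for n
  have X_K: "X n \<in> K" for n
    unfolding X_def by (rule R_pow_in_K[OF rs_in_K])
  have X_dec: "decseq X"
    unfolding X_def by (rule R_pow_rs_decseq)
  have "seq_compact (closure (range X))"
    using assms unfolding precompact_def X_def by (simp add: compact_imp_seq_compact)
  moreover have "\<forall>n. X n \<in> closure (range X)"
    using closure_subset[of "range X"] by blast
  ultimately obtain W \<sigma> where \<sigma>: "strict_mono \<sigma>" and lim: "(X \<circ> \<sigma>) \<longlonglongrightarrow> W"
    by (rule seq_compactE) blast
  have X_le: "ev (X n) p $ i \<le> ev (X m) p $ i" if "m \<le> n" for m n p i
    using ev_mono[OF decseqD[OF X_dec that]] by (simp add: less_eq_vec_def)
  have ev_lim: "(\<lambda>n. ev (X n) p $ i) \<longlonglongrightarrow> ev W p $ i" for p i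
  proof -
    have dec: "decseq (\<lambda>n. ev (X n) p $ i)"
      by (intro decseq_SucI X_le) simp
    moreover have "0 \<le> ev (X n) p $ i" for n
      using ev_mono[of 0 "X n" p] X_K[of n] by (simp add: less_eq_vec_def)
    ultimately obtain l where l: "(\<lambda>n. ev (X n) p $ i) \<longlonglongrightarrow> l"
      using decseq_convergent[of "\<lambda>n. ev (X n) p $ i" 0] by blast
    have "((\<lambda>n. ev (X n) p $ i) \<circ> \<sigma>) \<longlonglongrightarrow> ev W p $ i"
      using tendsto_vec_nth[OF tendsto_ev[OF lim, of p], of i] by (simp add: comp_def)
    with LIMSEQ_subseq_LIMSEQ[OF l \<sigma>] have "l = ev W p $ i"
      by (rule LIMSEQ_unique)
    with l show ?thesis
      by simp
  qed
  have W_le_X: "W \<le> X n" for n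
  proof -
    have "ev W p $ i \<le> ev (X n) p $ i" for p i
    proof (rule LIMSEQ_le_const2[OF ev_lim])
      show "\<exists>N. \<forall>m\<ge>N. ev (X m) p $ i \<le> ev (X n) p $ i"
        using X_le by blast
    qed
    then show ?thesis
      by (auto simp: less_eq_CMX.rep_eq less_eq_vec_def)
  qed
  have le_W: "\<psi> \<le> W" if "\<And>n. \<psi> \<le> X n" for \<psi>
  proof -
    have "ev \<psi> p $ i \<le> ev W p $ i" for p i
      using ev_mono[OF that] by (intro LIMSEQ_le_const[OF ev_lim]) (simp add: less_eq_vec_def)
    then show ?thesis
      by (auto simp: less_eq_CMX.rep_eq less_eq_vec_def)
  qed
  have W_K: "W \<in> K"
    using le_W[of 0] X_K W_le_X[of 0] by (auto simp: X_def)
  show thesis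
  proof
    show "W \<in> K" by fact
    show "W \<le> (R x0 ^^ n) (of_Y rs)" for n
      using W_le_X unfolding X_def .
    show "R x0 W = W"
    proof (rule CMX_eqI)
      fix p :: "'m \<times> real"
      obtain \<theta> x where p: "p = (\<theta>, x)"
        by (cases p)
      have "(\<lambda>n. Q ((X \<circ> \<sigma>) n)) \<longlonglongrightarrow> Q W"
        using X_K W_K by (intro continuous_on_tendsto_compose[OF Q_continuous lim]) auto
      from tendsto_ev[OF this, of "(\<theta>, x - x0)"]
      have 1: "(\<lambda>n. ev (X (Suc (\<sigma> n))) p) \<longlonglongrightarrow> ev (R x0 W) p"
        by (simp add: p X_def)
      have "(\<lambda>n. ev (X n) p) \<longlonglongrightarrow> ev W p"
        by (rule vec_tendstoI) (rule ev_lim)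
      then have "(\<lambda>n. ev (X (Suc n)) p) \<longlonglongrightarrow> ev W p"
        by (rule LIMSEQ_Suc)
      from LIMSEQ_subseq_LIMSEQ[OF this \<sigma>] have "(\<lambda>n. ev (X (Suc (\<sigma> n))) p) \<longlonglongrightarrow> ev W p"
        by (simp add: comp_def)
      with 1 show "ev (R x0 W) p = ev W p"
        by (rule LIMSEQ_unique)
    qed
    show "mono (\<lambda>s. ev W (\<theta>, s))" for \<theta>
    proof (rule monoI)
      fix s t :: real
      assume "s \<le> t"
      then have "ev (X n) (\<theta>, s) \<le> ev (X n) (\<theta>, t)" for n
        using ev_mono[OF R_pow_rs_nondecreasing[of "t - s" n x0], of "(\<theta>, s)"] by (simp add: X_def)
      then have "ev W (\<theta>, s) $ i \<le> ev W (\<theta>, t) $ i" for i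
        by (intro LIMSEQ_le[OF ev_lim ev_lim]) (auto simp: less_eq_vec_def)
      then show "ev W (\<theta>, s) \<le> ev W (\<theta>, t)"
        by (simp add: less_eq_vec_def)
    qed
    show "\<psi> \<le> W" if \<psi>: "\<psi> \<in> K" "1 \<le> k" "\<psi> \<le> (R x0 ^^ k) \<psi>" for \<psi> k
    proof (rule le_W)
      fix n
      have "\<psi> \<le> X (k * n)"
      proof (induction n)
        case 0
        show ?case
          using \<psi>(1) by (simp add: X_def)
      next
        case (Suc n)
        have "\<psi> \<le> (R x0 ^^ k) \<psi>" by fact
        also have "\<dots> \<le> (R x0 ^^ k) (X (k * n))"
          by (intro R_pow_mono \<psi>(1) X_K Suc.IH)
        also have "\<dots> = X (k * Suc n)"
          by (simp add: X_def funpow_add)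
        finally show ?case .
      qed
      also have "X (k * n) \<le> X n"
        using \<psi>(2) by (intro decseqD[OF X_dec]) auto
      finally show "\<psi> \<le> X n" .
    qed
  qed
qed

text \<open>Since \<open>r\<close> is constant in space, (A3) gives \<open>T\<^bsub>-y\<^esub> Q\<^sup>n[r] \<rightarrow> Q\<^sub>-\<^sup>n[r]\<close> as \<open>y \<rightarrow> -\<infinity>\<close>, and (UAA)
  makes the limit small for large \<open>n\<close>.\<close>

lemma slice_tendsto_0:
  assumes A3: "A3 Q" and UAA: "UAA (Q_minus Q)"
    and W: "0 \<le> W" "\<And>n. W \<le> (Q ^^ n) (of_Y rs)"
  shows "(slice W \<longlongrightarrow> 0) at_bot"
proof (rule slice_tendstoI)
  fix e :: real
  assume "0 < e"
  let ?P = "\<lambda>n. (Q_minus Q ^^ n) (of_Y rs)"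
  define c where "c = e / (2 * real CARD('n))"
  have "0 < c"
    using \<open>0 < e\<close> by (simp add: c_def)
  have rs_C: "of_Y rs \<in> C_plus"
    using rs_nonneg by (simp add: C_plus_def)
  then have "(\<lambda>n. SUP p. ev (?P n) p) \<longlonglongrightarrow> 0"
    using UAA unfolding UAA_def by blast
  then have "\<forall>\<^sub>F n in sequentially. dist (SUP p. ev (?P n) p) 0 < c"
    using \<open>0 < c\<close> by (rule tendstoD)
  then obtain n where n: "norm (SUP p. ev (?P n) p) < c"
    by (auto simp: eventually_sequentially)
  have P_le: "ev (?P n) p $ i \<le> c" for p i
  proof -
    obtain a b where "range (ev (?P n)) \<subseteq> cbox a b"
      using bounded_subset_cbox_symmetric[OF bounded_ev[of "?P n"]] by blast
    then have "bdd_above (range (ev (?P n)))"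
      by (intro bdd_aboveI[of _ b]) (auto simp: cbox_interval)
    then have "ev (?P n) p \<le> (SUP p. ev (?P n) p)"
      by (intro cSUP_upper) auto
    then have "ev (?P n) p $ i \<le> (SUP p. ev (?P n) p) $ i"
      by (simp add: less_eq_vec_def)
    also have "\<dots> \<le> c"
      using component_le_norm_cart[of "SUP p. ev (?P n) p" i] n by linarith
    finally show ?thesis .
  qed
  have "((\<lambda>y. T (- y) ((Q ^^ n) (T y (of_Y rs)))) \<longlongrightarrow> ?P n) at_bot"
    using A3 rs_C unfolding A3_def by blast
  from CMX_tendsto_locally_uniform[OF this \<open>0 < c\<close>, of 0]
  have "\<forall>\<^sub>F y in at_bot. \<forall>\<theta>. norm (ev ((Q ^^ n) (of_Y rs)) (\<theta>, y) - ev (?P n) (\<theta>, 0)) < c"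
    by (rule eventually_mono) simp
  then show "\<forall>\<^sub>F y in at_bot. \<forall>\<theta>. norm (ev W (\<theta>, y) - apply_bcontfun 0 \<theta>) \<le> e"
  proof (rule eventually_mono, intro allI)
    fix y \<theta>
    assume *: "\<forall>\<theta>. norm (ev ((Q ^^ n) (of_Y rs)) (\<theta>, y) - ev (?P n) (\<theta>, 0)) < c"
    have "\<bar>ev W (\<theta>, y) $ i\<bar> \<le> 2 * c" for i
    proof -
      have "0 \<le> ev W (\<theta>, y) $ i"
        using ev_mono[OF W(1), of "(\<theta>, y)"] by (simp add: less_eq_vec_def)
      moreover have "ev W (\<theta>, y) $ i \<le> ev ((Q ^^ n) (of_Y rs)) (\<theta>, y) $ i"
        using ev_mono[OF W(2)] by (simp add: less_eq_vec_def)
      moreover have "ev ((Q ^^ n) (of_Y rs)) (\<theta>, y) $ i - ev (?P n) (\<theta>, 0) $ i < c"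
        using component_le_norm_cart[of "ev ((Q ^^ n) (of_Y rs)) (\<theta>, y) - ev (?P n) (\<theta>, 0)" i]
          *[rule_format, of \<theta>] by simp
      ultimately show ?thesis
        using P_le[of "(\<theta>, 0)" i] by linarith
    qed
    then have "(\<Sum>i\<in>UNIV. \<bar>ev W (\<theta>, y) $ i\<bar>) \<le> real CARD('n) * (2 * c)"
      by (intro sum_bounded_above) auto
    then show "norm (ev W (\<theta>, y) - apply_bcontfun 0 \<theta>) \<le> e"
      using norm_le_l1_cart[of "ev W (\<theta>, y)"] by (simp add: c_def)
  qed
qed

section \<open>Spreading in a moving frame\<close>

text \<open>Seen from the place \<open>y\<close> of the initial profile, the window \<open>\<bar>x\<bar> \<le> L\<close> for \<open>R\<^sup>n\<close> is the window
  shifted by \<open>- n x0\<close> for \<open>Q\<^sup>n\<close>. As \<open>- cm < - x0 < cp\<close>, the latter lies in the range of (UC) for large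
  \<open>n\<close>. Fixing such an \<open>n\<close> first, (A3) carries the estimate from \<open>Q\<^sub>+\<^sup>n\<close> over to \<open>Q\<^sup>n\<close> for large \<open>y\<close>.\<close>

lemma spreading_lower_bound:
  assumes A3: "A3 Q" and UC: "UC (Q_plus Q) cm cp rs"
    and x0: "0 \<le> x0" "- cp < x0" "x0 < cm"
    and \<phi>: "\<phi> \<in> K" "\<phi> \<noteq> 0" and e: "0 < e"
  obtains n where "1 \<le> n"
    "\<forall>\<^sub>F y in at_top. \<forall>\<theta> x i. \<bar>x\<bar> \<le> L \<longrightarrow>
      apply_bcontfun rs \<theta> $ i - e \<le> ev ((R x0 ^^ n) (T y \<phi>)) (\<theta>, x + y) $ i"
proof -
  let ?P = "\<lambda>n. (Q_plus Q ^^ n) \<phi>"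
  \<comment> \<open>Half of the smaller of the two speeds in the moving frame.\<close>
  define \<epsilon> where "\<epsilon> = min (cm - x0) (cp + x0) / 2"
  let ?I = "\<lambda>n. (*) (real n) ` {- cm + \<epsilon>..cp - \<epsilon>}"
  have \<epsilon>: "0 < \<epsilon>" "2 * \<epsilon> \<le> cm - x0" "2 * \<epsilon> \<le> cp + x0"
    using x0 by (auto simp: \<epsilon>_def)
  have \<phi>_C: "\<phi> \<in> C_plus"
    using \<phi>(1) by (simp add: C_plus_def)
  have "\<epsilon> \<in> {0<..<(cp + cm) / 2}"
    using \<epsilon> by auto
  then have "(\<lambda>n. SUP x\<in>?I n. norm (slice (?P n) x - rs)) \<longlonglongrightarrow> 0"
    using UC \<phi>_C \<phi>(2) unfolding UC_def by blast
  then have "\<forall>\<^sub>F n in sequentially. dist (SUP x\<in>?I n. norm (slice (?P n) x - rs)) 0 < e / 2"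
    using e by (intro tendstoD) auto
  moreover obtain k where k: "L / \<epsilon> \<le> real k"
    using real_arch_simple by blast
  have "\<forall>\<^sub>F n in sequentially. max 1 k \<le> n"
    by (rule eventually_ge_at_top)
  ultimately have "\<forall>\<^sub>F n in sequentially.
      dist (SUP x\<in>?I n. norm (slice (?P n) x - rs)) 0 < e / 2 \<and> max 1 k \<le> n"
    by (rule eventually_conj)
  from eventually_happens'[OF sequentially_bot this]
  obtain n where n: "max 1 k \<le> n" "(SUP x\<in>?I n. norm (slice (?P n) x - rs)) < e / 2"
    by (auto simp del: max.bounded_iff)
  have L: "L \<le> real n * \<epsilon>"
  proof -
    have "L / \<epsilon> \<le> real n"
      using k n(1) by linarith
    then show ?thesis
      using \<epsilon>(1) by (simp add: field_simps)
  qed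
  have P_near: "norm (ev (?P n) (\<theta>, x - real n * x0) - apply_bcontfun rs \<theta>) < e / 2"
    if x: "\<bar>x\<bar> \<le> L" for \<theta> x
  proof -
    obtain B where B: "\<And>p. norm (ev (?P n) p) \<le> B"
      using ev_bound_obtains[of "?P n"] by blast
    have "norm (slice (?P n) x - rs) \<le> B + norm rs" for x
    proof -
      have "norm (slice (?P n) x) \<le> B"
        by (rule norm_bound) (simp add: B)
      then show ?thesis
        using norm_triangle_ineq4[of "slice (?P n) x" rs] by linarith
    qed
    then have bdd: "bdd_above ((\<lambda>x. norm (slice (?P n) x - rs)) ` ?I n)"
      by (intro bdd_aboveI[of _ "B + norm rs"]) auto
    have "x - real n * x0 \<in> ?I n"
    proof
      show "x - real n * x0 = real n * ((x - real n * x0) / real n)"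
        using n(1) by simp
      have "real n * \<epsilon> \<le> real n * (cm - x0 - \<epsilon>)" "real n * \<epsilon> \<le> real n * (cp + x0 - \<epsilon>)"
        using \<epsilon> by (auto intro!: mult_left_mono)
      then have "- real n * (cm - x0 - \<epsilon>) \<le> x" "x \<le> real n * (cp + x0 - \<epsilon>)"
        using L x by auto
      then show "(x - real n * x0) / real n \<in> {- cm + \<epsilon>..cp - \<epsilon>}"
        using n(1) by (auto simp: field_simps)
    qed
    from cSUP_upper[OF this bdd] have "norm (slice (?P n) (x - real n * x0) - rs) < e / 2"
      using n(2) by linarith
    moreover have "norm (apply_bcontfun (slice (?P n) (x - real n * x0) - rs) \<theta>)
        \<le> norm (slice (?P n) (x - real n * x0) - rs)"
      by (rule norm_bounded)
    ultimately show ?thesis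
      by simp
  qed
  have "((\<lambda>y. T (- y) ((Q ^^ n) (T y \<phi>))) \<longlongrightarrow> ?P n) at_top"
    using A3 \<phi>_C unfolding A3_def by blast
  from CMX_tendsto_locally_uniform[OF this, of "e / 2" "L + real n * x0"]
  have ev: "\<forall>\<^sub>F y in at_top. \<forall>\<theta> x. \<bar>x\<bar> \<le> L + real n * x0 \<longrightarrow>
      norm (ev ((Q ^^ n) (T y \<phi>)) (\<theta>, x + y) - ev (?P n) (\<theta>, x)) < e / 2"
    using e by simp
  show thesis
  proof
    show "1 \<le> n"
      using n(1) by simp
    show "\<forall>\<^sub>F y in at_top. \<forall>\<theta> x i. \<bar>x\<bar> \<le> L \<longrightarrow>
      apply_bcontfun rs \<theta> $ i - e \<le> ev ((R x0 ^^ n) (T y \<phi>)) (\<theta>, x + y) $ i"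
      using ev
    proof (rule eventually_mono, intro allI impI)
      fix y \<theta> x i
      assume y: "\<forall>\<theta> x. \<bar>x\<bar> \<le> L + real n * x0 \<longrightarrow>
          norm (ev ((Q ^^ n) (T y \<phi>)) (\<theta>, x + y) - ev (?P n) (\<theta>, x)) < e / 2"
        and x: "\<bar>x\<bar> \<le> L"
      define u where "u = ev ((Q ^^ n) (T y \<phi>)) (\<theta>, x - real n * x0 + y)"
      define v where "v = ev (?P n) (\<theta>, x - real n * x0)"
      have "0 \<le> real n * x0"
        using x0(1) by simp
      then have "\<bar>x - real n * x0\<bar> \<le> L + real n * x0"
        using x by linarith
      then have "norm (u - v) < e / 2"
        using y unfolding u_def v_def by blast
      moreover have "norm (v - apply_bcontfun rs \<theta>) < e / 2"
        unfolding v_def using x by (rule P_near)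
      ultimately have "apply_bcontfun rs \<theta> $ i - e \<le> u $ i"
        using component_le_norm_cart[of "u - v" i]
          component_le_norm_cart[of "v - apply_bcontfun rs \<theta>" i] by simp
      also have "T (real n * x0) ((Q ^^ n) (T y \<phi>)) \<le> (R x0 ^^ n) (T y \<phi>)"
        using \<phi>(1) x0(1) by (intro T_Q_pow_le_R_pow T_interval)
      from ev_mono[OF this, of "(\<theta>, x + y)"]
      have "u $ i \<le> ev ((R x0 ^^ n) (T y \<phi>)) (\<theta>, x + y) $ i"
        by (simp add: u_def less_eq_vec_def algebra_simps)
      finally show "apply_bcontfun rs \<theta> $ i - e \<le> ev ((R x0 ^^ n) (T y \<phi>)) (\<theta>, x + y) $ i" .
    qed
  qed
qed

text \<open>With \<open>r \<ge> 2 \<delta>\<close>, a tent of height \<open>\<delta>\<close> that is placed far to the right has grown to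
  \<open>r - \<delta> \<ge> \<delta>\<close> on its support after sufficiently many steps.\<close>

lemma bump_below_iterate:
  assumes M: "compact (UNIV :: 'm set)" and rs: "rs \<in> Int_Y_plus"
    and A3: "A3 Q" and UC: "UC (Q_plus Q) cm cp rs"
    and x0: "0 \<le> x0" "- cp < x0" "x0 < cm"
  obtains \<psi> n where "\<psi> \<in> K" "\<psi> \<noteq> 0" "1 \<le> n" "\<psi> \<le> (R x0 ^^ n) \<psi>"
proof -
  have "\<exists>d>0. \<forall>\<theta>. 2 * d \<le> apply_bcontfun rs \<theta> $ i" for i
  proof -
    have "continuous_on UNIV (\<lambda>\<theta>. apply_bcontfun rs \<theta> $ i)"
      by (intro continuous_on_component continuous_on_apply_bcontfun)
    with M obtain \<theta>\<^sub>0 where "\<And>\<theta>. apply_bcontfun rs \<theta>\<^sub>0 $ i \<le> apply_bcontfun rs \<theta> $ i"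
      using continuous_attains_inf[of "UNIV :: 'm set" "\<lambda>\<theta>. apply_bcontfun rs \<theta> $ i"] by auto
    moreover have "0 < apply_bcontfun rs \<theta>\<^sub>0 $ i"
      using rs by (auto simp: Int_Y_plus_def Int_R_plus_iff)
    ultimately show ?thesis
      by (intro exI[of _ "apply_bcontfun rs \<theta>\<^sub>0 $ i / 2"]) auto
  qed
  then obtain d where d: "\<And>i. 0 < d i" "\<And>i \<theta>. 2 * d i \<le> apply_bcontfun rs \<theta> $ i"
    by metis
  define \<delta> where "\<delta> = Min (range d)"
  have \<delta>: "0 < \<delta>" "\<And>i \<theta>. 2 * \<delta> \<le> apply_bcontfun rs \<theta> $ i"
  proof -
    show "0 < \<delta>"
      using d(1) by (simp add: \<delta>_def)
    have "\<delta> \<le> d i" for i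
      by (simp add: \<delta>_def)
    then show "2 * \<delta> \<le> apply_bcontfun rs \<theta> $ i" for i \<theta>
      using d(2)[of i \<theta>] by (smt (verit))
  qed
  define tent :: "real \<Rightarrow> real" where "tent x = \<delta> * max 0 (1 - \<bar>x\<bar>)" for x
  have tent: "0 \<le> tent x" "tent x \<le> \<delta>" "1 \<le> \<bar>x\<bar> \<Longrightarrow> tent x = 0" for x
    using \<delta>(1) by (auto simp: tent_def mult_left_le)
  define \<phi> :: "('m, 'n) CMX" where "\<phi> = Abs_CMX (\<lambda>p. \<chi> i. tent (snd p))"
  have "(\<lambda>p. \<chi> i. tent (snd p)) \<in> (bcontfun :: ('m \<times> real \<Rightarrow> real ^ 'n) set)"
  proof -
    have "continuous_on UNIV (\<lambda>p :: 'm \<times> real. \<chi> i :: 'n. tent (snd p))"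
      unfolding tent_def by (intro continuous_intros)
    moreover have "norm (\<chi> i :: 'n. tent (snd p)) \<le> real CARD('n) * \<delta>" for p :: "'m \<times> real"
    proof -
      have "norm (\<chi> i :: 'n. tent (snd p)) \<le> (\<Sum>i :: 'n\<in>UNIV. \<bar>tent (snd p)\<bar>)"
        using norm_le_l1_cart[of "\<chi> i :: 'n. tent (snd p)"] by simp
      also have "\<dots> \<le> real CARD('n) * \<delta>"
        using tent(1,2) by (intro sum_bounded_above) auto
      finally show ?thesis .
    qed
    ultimately show ?thesis
      unfolding bcontfun_def by (auto intro!: boundedI[of _ "real CARD('n) * \<delta>"])
  qed
  then have ev_\<phi>: "ev \<phi> (\<theta>, x) = (\<chi> i. tent x)" for \<theta> x
    by (simp add: \<phi>_def Abs_CMX_inverse)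
  have \<phi>_K: "\<phi> \<in> K"
  proof -
    have "tent x \<le> apply_bcontfun rs \<theta> $ i" for x \<theta> i
      using tent(2)[of x] \<delta>(1) \<delta>(2)[of \<theta> i] by linarith
    then show ?thesis
      using tent(1) by (auto intro!: CMX_leI simp: ev_\<phi> less_eq_vec_def)
  qed
  have T_\<phi>_nonzero: "T y \<phi> \<noteq> 0" for y
  proof
    assume "T y \<phi> = 0"
    then have "ev (T y \<phi>) (undefined, y) = 0"
      by simp
    then show False
      using \<delta>(1) by (simp add: ev_\<phi> tent_def vec_eq_iff)
  qed
  then have "\<phi> \<noteq> 0"
    using T_0 by metis
  from spreading_lower_bound[OF A3 UC x0 \<phi>_K this \<delta>(1), of 1]
  obtain n where "1 \<le> n" and "\<forall>\<^sub>F y in at_top. \<forall>\<theta> x i. \<bar>x\<bar> \<le> 1 \<longrightarrow>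
      apply_bcontfun rs \<theta> $ i - \<delta> \<le> ev ((R x0 ^^ n) (T y \<phi>)) (\<theta>, x + y) $ i"
    by blast
  then obtain y where y: "\<And>\<theta> x i. \<bar>x\<bar> \<le> 1 \<Longrightarrow>
      apply_bcontfun rs \<theta> $ i - \<delta> \<le> ev ((R x0 ^^ n) (T y \<phi>)) (\<theta>, x + y) $ i"
    using eventually_happens'[OF trivial_limit_at_top_linorder] by blast
  show thesis
  proof
    show T_K: "T y \<phi> \<in> K"
      using \<phi>_K by (rule T_interval)
    show "T y \<phi> \<noteq> 0"
      by (rule T_\<phi>_nonzero)
    show "1 \<le> n" by fact
    show "T y \<phi> \<le> (R x0 ^^ n) (T y \<phi>)"
    proof (rule CMX_leI)
      fix \<theta> x
      have "tent (x - y) \<le> ev ((R x0 ^^ n) (T y \<phi>)) (\<theta>, x) $ i" for i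
      proof (cases "\<bar>x - y\<bar> \<le> 1")
        case True
        then have "apply_bcontfun rs \<theta> $ i - \<delta> \<le> ev ((R x0 ^^ n) (T y \<phi>)) (\<theta>, x) $ i"
          using y[of "x - y" \<theta> i] by simp
        then show ?thesis
          using tent(2)[of "x - y"] \<delta>(2)[of \<theta> i] by linarith
      next
        case False
        have "0 \<le> (R x0 ^^ n) (T y \<phi>)"
          using R_pow_in_K[OF T_K, of n x0] by simp
        from ev_mono[OF this, of "(\<theta>, x)"] show ?thesis
          using False tent(3)[of "x - y"] by (simp add: less_eq_vec_def)
      qed
      then show "ev (T y \<phi>) (\<theta>, x) \<le> ev ((R x0 ^^ n) (T y \<phi>)) (\<theta>, x)"
        by (simp add: ev_\<phi> less_eq_vec_def)
    qed
  qed
qed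

text \<open>For \<open>y \<ge> 0\<close> the fixed point lies above its translate \<open>T y V\<close>, hence also above \<open>R\<^sup>n[T y V]\<close>,
  whose value at \<open>y\<close> is almost \<open>r\<close>. A function above \<open>V\<close> is allowed because in the end the limit is needed
  for the fixed point of \<open>Q\<close>, not of \<open>R\<close>.\<close>

lemma fixed_point_tendsto_at_top:
  assumes A3: "A3 Q" and UC: "UC (Q_plus Q) cm cp rs"
    and x0: "0 \<le> x0" "- cp < x0" "x0 < cm"
    and V: "V \<in> K" "V \<noteq> 0" "R x0 V = V" "\<And>\<theta>. mono (\<lambda>s. ev V (\<theta>, s))"
    and W: "V \<le> W" "W \<in> K"
  shows "(slice W \<longlongrightarrow> rs) at_top"
proof (rule slice_tendstoI)
  fix e :: real
  assume "0 < e"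
  define c where "c = e / real CARD('n)"
  have "0 < c"
    using \<open>0 < e\<close> by (simp add: c_def)
  from spreading_lower_bound[OF A3 UC x0 V(1,2) this, of 0]
  obtain n where n: "\<forall>\<^sub>F y in at_top. \<forall>\<theta> x i. \<bar>x\<bar> \<le> 0 \<longrightarrow>
      apply_bcontfun rs \<theta> $ i - c \<le> ev ((R x0 ^^ n) (T y V)) (\<theta>, x + y) $ i"
    by blast
  have V_fix: "(R x0 ^^ n) V = V"
    using V(3) by (induction n) auto
  show "\<forall>\<^sub>F y in at_top. \<forall>\<theta>. norm (ev W (\<theta>, y) - apply_bcontfun rs \<theta>) \<le> e"
    using eventually_conj[OF n eventually_ge_at_top[of 0]]
  proof (rule eventually_mono, intro allI, elim conjE)
    fix y :: real and \<theta>
    assume y: "\<forall>\<theta> x i. \<bar>x\<bar> \<le> 0 \<longrightarrow>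
      apply_bcontfun rs \<theta> $ i - c \<le> ev ((R x0 ^^ n) (T y V)) (\<theta>, x + y) $ i" and "0 \<le> y"
    have "T y V \<le> V"
      using \<open>0 \<le> y\<close> by (intro CMX_leI) (auto intro: monoD[OF V(4)])
    then have "(R x0 ^^ n) (T y V) \<le> (R x0 ^^ n) V"
      by (intro R_pow_mono T_interval V(1))
    then have le: "(R x0 ^^ n) (T y V) \<le> W"
      using V_fix W(1) by simp
    have "\<bar>(ev W (\<theta>, y) - apply_bcontfun rs \<theta>) $ i\<bar> \<le> c" for i
    proof -
      have "apply_bcontfun rs \<theta> $ i - c \<le> ev ((R x0 ^^ n) (T y V)) (\<theta>, y) $ i"
        using y[rule_format, of 0 \<theta> i] by simp
      also have "\<dots> \<le> ev W (\<theta>, y) $ i"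
        using ev_mono[OF le] by (simp add: less_eq_vec_def)
      finally have "apply_bcontfun rs \<theta> $ i - c \<le> ev W (\<theta>, y) $ i" .
      moreover have "ev W (\<theta>, y) $ i \<le> apply_bcontfun rs \<theta> $ i"
        using ev_mono[of W "of_Y rs" "(\<theta>, y)"] W(2) by (simp add: less_eq_vec_def)
      ultimately show ?thesis
        using \<open>0 < c\<close> by simp
    qed
    then have "(\<Sum>i\<in>UNIV. \<bar>(ev W (\<theta>, y) - apply_bcontfun rs \<theta>) $ i\<bar>) \<le> real CARD('n) * c"
      by (intro sum_bounded_above) auto
    then show "norm (ev W (\<theta>, y) - apply_bcontfun rs \<theta>) \<le> e"
      using norm_le_l1_cart[of "ev W (\<theta>, y) - apply_bcontfun rs \<theta>"] by (simp add: c_def)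
  qed
qed

section \<open>The connecting fixed point\<close>

lemma connecting_fixed_point_exists:
  assumes M: "compact (UNIV :: 'm set)" and rs: "rs \<in> Int_Y_plus"
    and A3: "A3 Q" and UAA: "UAA (Q_minus Q)" and UC: "UC (Q_plus Q) cm cp rs"
    and x0: "0 \<le> x0" "- cp < x0" "x0 < cm"
    and Q_precompact: "precompact (range (\<lambda>n. (Q ^^ n) (of_Y rs)))"
    and R_precompact: "precompact (range (\<lambda>n. (R x0 ^^ n) (of_Y rs)))"
  shows "\<exists>W. connecting_fixed_point Q rs W"
proof -
  have R_0: "R 0 = Q"
    by (rule ext) simp
  obtain V where V: "V \<in> K" "R x0 V = V" "\<And>n. V \<le> (R x0 ^^ n) (of_Y rs)"
    "\<And>\<theta>. mono (\<lambda>s. ev V (\<theta>, s))"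
    "\<And>\<psi> k. \<lbrakk>\<psi> \<in> K; 1 \<le> k; \<psi> \<le> (R x0 ^^ k) \<psi>\<rbrakk> \<Longrightarrow> \<psi> \<le> V"
    by (fact greatest_fixed_point[OF R_precompact])
  obtain \<psi> n where \<psi>: "\<psi> \<in> K" "\<psi> \<noteq> 0" "1 \<le> n" "\<psi> \<le> (R x0 ^^ n) \<psi>"
    by (rule bump_below_iterate[OF M rs A3 UC x0])
  from V(5)[OF \<psi>(1,3,4)] have "V \<noteq> 0"
    using \<psi>(1,2) by auto
  obtain W where W: "W \<in> K" "Q W = W" "\<And>n. W \<le> (Q ^^ n) (of_Y rs)"
    "\<And>\<theta>. mono (\<lambda>s. ev W (\<theta>, s))"
    "\<And>\<psi> k. \<lbrakk>\<psi> \<in> K; 1 \<le> k; \<psi> \<le> (Q ^^ k) \<psi>\<rbrakk> \<Longrightarrow> \<psi> \<le> W"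
    by (fact greatest_fixed_point[of 0, unfolded R_0, OF Q_precompact])
  have "V \<le> Q V"
  proof (rule CMX_leI)
    fix \<theta> x
    have "ev V (\<theta>, x) \<le> ev V (\<theta>, x + x0)"
      using x0(1) by (intro monoD[OF V(4)]) simp
    also have "\<dots> = ev (R x0 V) (\<theta>, x + x0)"
      unfolding V(2) ..
    also have "\<dots> = ev (Q V) (\<theta>, x)"
      by simp
    finally show "ev V (\<theta>, x) \<le> ev (Q V) (\<theta>, x)" .
  qed
  then have "V \<le> W"
    using W(5)[OF V(1), of 1] by simp
  have "(slice W \<longlongrightarrow> rs) at_top"
    using fixed_point_tendsto_at_top[OF A3 UC x0 V(1) \<open>V \<noteq> 0\<close> V(2,4) \<open>V \<le> W\<close> W(1)] .
  moreover have "(slice W \<longlongrightarrow> 0) at_bot"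
    using W(1,3) by (intro slice_tendsto_0[OF A3 UAA]) auto
  moreover have "W \<in> C_plus - {0}"
    using W(1) V(1) \<open>V \<noteq> 0\<close> \<open>V \<le> W\<close> by (auto simp: C_plus_def)
  ultimately show ?thesis
    using W(2,4) unfolding connecting_fixed_point_def by blast
qed

end

text \<open>By (A1) the maps \<open>T\<^bsub>-y\<^esub> Q T\<^bsub>y\<^esub>\<close> increase in \<open>y\<close> to \<open>Q\<^sub>+\<close>, and \<open>Q\<close> is the one with \<open>y = 0\<close>.\<close>

lemma Q_le_Q_plus:
  assumes A1: "A1 Q" and A3: "A3 Q" and \<phi>: "\<phi> \<in> C_plus"
  shows "Q \<phi> \<le> Q_plus Q \<phi>"
proof -
  have le: "Q \<phi> \<le> T (- y) (Q (T y \<phi>))" if "0 \<le> y" for y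
  proof -
    have "T y \<phi> \<in> C_plus"
      using \<phi> T_mono[of 0 \<phi> y] by (simp add: C_plus_def)
    then have "Q (T (- y) (T y \<phi>)) \<le> T (- y) (Q (T y \<phi>))"
      using A1 that unfolding A1_def by blast
    then show ?thesis
      by simp
  qed
  have "((\<lambda>y. T (- y) ((Q ^^ 1) (T y \<phi>))) \<longlongrightarrow> (Q_plus Q ^^ 1) \<phi>) at_top"
    using A3 \<phi> unfolding A3_def by blast
  then have lim: "((\<lambda>y. T (- y) (Q (T y \<phi>))) \<longlongrightarrow> Q_plus Q \<phi>) at_top"
    by simp
  have "ev (Q \<phi>) p $ i \<le> ev (Q_plus Q \<phi>) p $ i" for p i
  proof (rule tendsto_lowerbound)
    show "((\<lambda>y. ev (T (- y) (Q (T y \<phi>))) p $ i) \<longlongrightarrow> ev (Q_plus Q \<phi>) p $ i) at_top"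
      by (intro tendsto_vec_nth tendsto_ev lim)
    show "\<forall>\<^sub>F y in at_top. ev (Q \<phi>) p $ i \<le> ev (T (- y) (Q (T y \<phi>))) p $ i"
      using eventually_ge_at_top[of 0]
      by (rule eventually_mono) (use ev_mono[OF le] in \<open>auto simp: less_eq_vec_def\<close>)
  qed simp
  then show ?thesis
    by (auto simp: less_eq_CMX.rep_eq less_eq_vec_def)
qed

theorem theorem3p3:
  fixes Q :: "('m::topological_space, 'n::finite) CMX \<Rightarrow> ('m, 'n) CMX"
    and rs :: "'m \<Rightarrow>\<^sub>C (real ^ 'n)"
    and cm cp :: real
  assumes "compact (UNIV :: 'm set)"
    and "Q \<in> C_plus \<rightarrow> C_plus"
    and "A1 Q" and "A2 Q" and "A3 Q" and "A4 Q rs"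
    and "UAA (Q_minus Q)"
    and "UC (Q_plus Q) cm cp rs"
    and "(subhomogeneous Q rs \<and> SP Q) \<or>
      (\<exists>cml cpl. ASH_UC_SP Q rs cml cpl \<and> cml \<longlonglongrightarrow> cm \<and> cpl \<longlonglongrightarrow> cp)"
    and "cm > 0"
    and "precompact (range (\<lambda>n. (Q ^^ n) (of_Y rs)))"
  shows "(cp > 0 \<longrightarrow> (\<exists>W. connecting_fixed_point Q rs W)) \<and>
    (cp \<le> 0 \<longrightarrow>
      (\<exists>x0\<in>{- cp<..<cm}. precompact (range (\<lambda>n. ((T x0 \<circ> Q) ^^ n) (of_Y rs)))) \<longrightarrow>
      (\<exists>W. connecting_fixed_point Q rs W))"
proof -
  have rs: "rs \<in> Int_Y_plus" and rs_fixed: "Q_plus Q (of_Y rs) = of_Y rs"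
    using \<open>A4 Q rs\<close> by (auto simp: A4_def)
  have nonneg: "0 \<le> of_Y rs"
    using rs by (intro CMX_leI) (auto simp: Int_Y_plus_def Int_R_plus_iff less_eq_vec_def less_imp_le)
  then have "Q (of_Y rs) \<le> of_Y rs"
    using Q_le_Q_plus[OF \<open>A1 Q\<close> \<open>A3 Q\<close>, of "of_Y rs"] rs_fixed by (simp add: C_plus_def)
  with assms nonneg interpret monotone_system Q rs
    by unfold_locales
  note exists = connecting_fixed_point_exists[OF assms(1) rs \<open>A3 Q\<close> assms(7,8) _ _ _ assms(11)]
  have "T 0 \<circ> Q = Q"
    by auto
  then have "\<exists>W. connecting_fixed_point Q rs W" if "cp > 0"
    using that assms(10,11) by (intro exists[of 0]) auto
  moreover have "\<exists>W. connecting_fixed_point Q rs W"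
    if "cp \<le> 0" "x0 \<in> {- cp<..<cm}" "precompact (range (\<lambda>n. ((T x0 \<circ> Q) ^^ n) (of_Y rs)))" for x0
    using that by (intro exists[of x0]) auto
  ultimately show ?thesis
    by blast
qed

end
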